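(* Let $\mathcal{D}$ be a set. The pre-Lie algebra morphism $\Phi_{PL}:Prelie(\mathcal{D})\to T(V_{\mathcal{D}},f_{\mathcal{D}})$, from the free pre-Lie algebra generated by $\mathcal{D}$, sending the generator indexed by $d$ to the biletter $\binom{0}{d}$ for all $d\in\mathcal{D}$, is injective.
   Context: $\mathbb{K}$ is a field of characteristic zero. Pre-Lie means right pre-Lie: $(a\bullet b)\bullet c-a\bullet(b\bullet c)=(a\bullet c)\bullet b-a\bullet(c\bullet b)$. The free pre-Lie algebra $Prelie(\mathcal{D})$ has as basis the isomorphism classes of rooted trees whose vertices are decorated by $\mathcal{D}$, with $t\bullet t'=\sum_{s}t\bullet_s t'$, the sum being over vertices $s$ of $t$, where $t\bullet_s t'$ is obtained by grafting the root of $t'$ on $s$; the generator indexed by $d$ is the one-vertex tree decorated by $d$. For a vector space $V$, $T(V)=\bigoplus_{n\ge 0}V^{\otimes n}$ is spanned by words with letters in $V$; $\emptyset$ is the empty word; juxtaposition is concatenation. The shuffle product $\sqcup\!\sqcup$ is the bilinear product with unit $\emptyset$ and $xu\sqcup\!\sqcup yv=x(u\sqcup\!\sqcup yv)+y(xu\sqcup\!\sqcup v)$. For a linear endomorphism $f$ of $V$, $T(V,f)$ is $T(V)$ with the pre-Lie product defined by $\emptyset\bullet w'=0$ and $(xw)\bullet w'=x(w\bullet w')+f(x)(w\sqcup\!\sqcup w')$ for $x\in V$, $w,w'\in T(V)$. $V_{\mathcal{D}}$ is the vector space with basis the biletters $\binom{k}{d}$, $(k,d)\in\mathbb{N}\times\mathcal{D}$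 (with $0\in\mathbb{N}$), and $f_{\mathcal{D}}:V_{\mathcal{D}}\to V_{\mathcal{D}}$ is the linear map with $f_{\mathcal{D}}\binom{k}{d}=\binom{k+1}{d}$. *)

theory Defs
  imports Complex_Main "HOL-Library.Poly_Mapping" "HOL-Library.Multiset"
begin

section \<open>Pre-Lie algebras and their morphisms\<close>

locale pre_lie_algebra = vector_space scale
  for scale :: "'k::field \<Rightarrow> 'a::ab_group_add \<Rightarrow> 'a" +
  fixes A :: "'a set" and prod :: "'a \<Rightarrow> 'a \<Rightarrow> 'a"
  assumes subspace_carrier: "subspace A"
    and prod_closed: "a \<in> A \<Longrightarrow> b \<in> A \<Longrightarrow> prod a b \<in> A"
    and prod_add_left: "a \<in> A \<Longrightarrow> b \<in> A \<Longrightarrow> c \<in> A \<Longrightarrow> prod (a + b) c = prod a c + prod b c"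
    and prod_add_right: "a \<in> A \<Longrightarrow> b \<in> A \<Longrightarrow> c \<in> A \<Longrightarrow> prod a (b + c) = prod a b + prod a c"
    and prod_scale_left: "a \<in> A \<Longrightarrow> b \<in> A \<Longrightarrow> prod (scale r a) b = scale r (prod a b)"
    and prod_scale_right: "a \<in> A \<Longrightarrow> b \<in> A \<Longrightarrow> prod a (scale r b) = scale r (prod a b)"
    and right_pre_lie: "a \<in> A \<Longrightarrow> b \<in> A \<Longrightarrow> c \<in> A \<Longrightarrow>
          prod (prod a b) c - prod a (prod b c) = prod (prod a c) b - prod a (prod c b)"

locale pre_lie_hom =
  dom: pre_lie_algebra s1 A m1 + cod: pre_lie_algebra s2 B m2
  for s1 :: "'k::field \<Rightarrow> 'a::ab_group_add \<Rightarrow> 'a" and A m1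
    and s2 :: "'k \<Rightarrow> 'b::ab_group_add \<Rightarrow> 'b" and B m2 +
  fixes \<phi> :: "'a \<Rightarrow> 'b"
  assumes hom_closed: "a \<in> A \<Longrightarrow> \<phi> a \<in> B"
    and hom_add: "a \<in> A \<Longrightarrow> b \<in> A \<Longrightarrow> \<phi> (a + b) = \<phi> a + \<phi> b"
    and hom_scale: "a \<in> A \<Longrightarrow> \<phi> (s1 r a) = s2 r (\<phi> a)"
    and hom_prod: "a \<in> A \<Longrightarrow> b \<in> A \<Longrightarrow> \<phi> (m1 a b) = m2 (\<phi> a) (\<phi> b)"


section \<open>Vector spaces with a given basis\<close>

text \<open>Formal linear combinations are elements of \<open>'b \<Rightarrow>\<^sub>0 'k\<close>; \<open>free_space B\<close> is the
  space with basis \<open>B\<close>, the basis vector indexed by \<open>x\<close> being \<open>single x 1\<close>.\<close>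

definition pm_scale :: "'k \<Rightarrow> ('b \<Rightarrow>\<^sub>0 'k) \<Rightarrow> ('b \<Rightarrow>\<^sub>0 'k::field)"
  where "pm_scale c = Poly_Mapping.map ((*) c)"

definition free_space :: "'b set \<Rightarrow> ('b \<Rightarrow>\<^sub>0 'k::field) set"
  where "free_space B = {p. Poly_Mapping.keys p \<subseteq> B}"

definition basis_vec :: "'b \<Rightarrow> ('b \<Rightarrow>\<^sub>0 'k::field)"
  where "basis_vec x = Poly_Mapping.single x 1"

definition lin_ext :: "('a \<Rightarrow> ('b \<Rightarrow>\<^sub>0 'k)) \<Rightarrow> ('a \<Rightarrow>\<^sub>0 'k) \<Rightarrow> ('b \<Rightarrow>\<^sub>0 'k::field)"
  where "lin_ext g p = (\<Sum>x\<in>Poly_Mapping.keys p. pm_scale (Poly_Mapping.lookup p x) (g x))"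

definition bilin_ext ::
    "('a \<Rightarrow> 'b \<Rightarrow> ('c \<Rightarrow>\<^sub>0 'k)) \<Rightarrow> ('a \<Rightarrow>\<^sub>0 'k) \<Rightarrow> ('b \<Rightarrow>\<^sub>0 'k) \<Rightarrow> ('c \<Rightarrow>\<^sub>0 'k::field)"
  where "bilin_ext g p q = lin_ext (\<lambda>x. lin_ext (g x) q) p"


section \<open>The free pre-Lie algebra on decorated rooted trees\<close>

text \<open>The children of a vertex form a multiset, so that elements of this type are exactly the
  isomorphism classes of (non-planar) decorated rooted trees.\<close>

datatype (decorations: 'd) rtree = Node 'd "'d rtree multiset"

lemma image_mset_fundef_cong [fundef_cong]:
  "M = N \<Longrightarrow> (\<And>x. x \<in># N \<Longrightarrow> f x = g x) \<Longrightarrow> image_mset f M = image_mset g N"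
  by (auto intro: image_mset_cong)

text \<open>\<open>graftings t t'\<close> is the multiset of the trees obtained by grafting the root of \<open>t'\<close> on a
  vertex \<open>s\<close> of \<open>t\<close>, one element for each \<open>s\<close>: either \<open>s\<close> is the root of \<open>t\<close> (first summand), or
  it is a vertex of the subtree \<open>u\<close> at one of the children of the root (second summand, where
  equal subtrees are counted with their multiplicity).\<close>

function graftings :: "'d rtree \<Rightarrow> 'd rtree \<Rightarrow> 'd rtree multiset" where
  "graftings (Node d F) t' =
     {# Node d (add_mset t' F) #} +
     (\<Sum>u\<in>#F. {# Node d (add_mset s (F - {#u#})). s \<in># graftings u t' #})"
  by pat_completeness auto
termination
  by (relation "measure (\<lambda>(t, _). size t)")
     (auto dest!: multi_member_split)

definition tree_prod :: "('d rtree \<Rightarrow>\<^sub>0 'k) \<Rightarrow> ('d rtree \<Rightarrow>\<^sub>0 'k) \<Rightarrow> ('d rtree \<Rightarrow>\<^sub>0 'k::field)"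
  where "tree_prod = bilin_ext (\<lambda>t t'. \<Sum>s\<in>#graftings t t'. basis_vec s)"

definition Prelie :: "'d set \<Rightarrow> ('d rtree \<Rightarrow>\<^sub>0 'k::field) set"
  where "Prelie D = free_space {t. decorations t \<subseteq> D}"

definition generator :: "'d \<Rightarrow> ('d rtree \<Rightarrow>\<^sub>0 'k::field)"
  where "generator d = basis_vec (Node d {#})"


section \<open>The pre-Lie algebra \<open>T(V, f)\<close>\<close>

text \<open>If \<open>V = free_space B\<close>, then \<open>T(V)\<close> has the words with letters in \<open>B\<close> as a basis.
  All operations below are multilinear, and are given on these words; the parameter \<open>f\<close> is
  meant to be linear and to map \<open>V\<close> to itself.\<close>

definition tensor_space :: "'b set \<Rightarrow> ('b list \<Rightarrow>\<^sub>0 'k::field) set"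
  where "tensor_space B = free_space (lists B)"

text \<open>Concatenation \<open>v w\<close> of a letter \<open>v \<in> V\<close> and an element \<open>w\<close> of \<open>T(V)\<close>.\<close>

definition letter_concat :: "('b \<Rightarrow>\<^sub>0 'k) \<Rightarrow> ('b list \<Rightarrow>\<^sub>0 'k) \<Rightarrow> ('b list \<Rightarrow>\<^sub>0 'k::field)"
  where "letter_concat = bilin_ext (\<lambda>x w. basis_vec (x # w))"

fun shuffle_words :: "'b list \<Rightarrow> 'b list \<Rightarrow> ('b list \<Rightarrow>\<^sub>0 'k::field)" where
  "shuffle_words [] v = basis_vec v"
| "shuffle_words u [] = basis_vec u"
| "shuffle_words (x # u) (y # v) =
     letter_concat (basis_vec x) (shuffle_words u (y # v)) +
     letter_concat (basis_vec y) (shuffle_words (x # u) v)"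

definition shuffle :: "('b list \<Rightarrow>\<^sub>0 'k) \<Rightarrow> ('b list \<Rightarrow>\<^sub>0 'k) \<Rightarrow> ('b list \<Rightarrow>\<^sub>0 'k::field)"
  where "shuffle = bilin_ext shuffle_words"

fun tensor_prod_words ::
    "(('b \<Rightarrow>\<^sub>0 'k) \<Rightarrow> ('b \<Rightarrow>\<^sub>0 'k)) \<Rightarrow> 'b list \<Rightarrow> 'b list \<Rightarrow> ('b list \<Rightarrow>\<^sub>0 'k::field)" where
  "tensor_prod_words f [] w' = 0"
| "tensor_prod_words f (x # w) w' =
     letter_concat (basis_vec x) (tensor_prod_words f w w') +
     letter_concat (f (basis_vec x)) (shuffle_words w w')"

definition tensor_prod ::
    "(('b \<Rightarrow>\<^sub>0 'k) \<Rightarrow> ('b \<Rightarrow>\<^sub>0 'k)) \<Rightarrow>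
     ('b list \<Rightarrow>\<^sub>0 'k) \<Rightarrow> ('b list \<Rightarrow>\<^sub>0 'k) \<Rightarrow> ('b list \<Rightarrow>\<^sub>0 'k::field)"
  where "tensor_prod f = bilin_ext (tensor_prod_words f)"


section \<open>Biletters and the morphism\<close>

definition biletters :: "'d set \<Rightarrow> (nat \<times> 'd) set"
  where "biletters D = UNIV \<times> D"

definition f_biletter :: "((nat \<times> 'd) \<Rightarrow>\<^sub>0 'k) \<Rightarrow> ((nat \<times> 'd) \<Rightarrow>\<^sub>0 'k::field)"
  where "f_biletter = lin_ext (\<lambda>(k, d). basis_vec (Suc k, d))"

definition is_Phi_PL ::
    "'d set \<Rightarrow> (('d rtree \<Rightarrow>\<^sub>0 'k) \<Rightarrow> ((nat \<times> 'd) list \<Rightarrow>\<^sub>0 'k::field)) \<Rightarrow> bool"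
  where "is_Phi_PL D \<Phi> \<longleftrightarrow>
    pre_lie_hom pm_scale (Prelie D) tree_prod
      pm_scale (tensor_space (biletters D)) (tensor_prod f_biletter) \<Phi> \<and>
    (\<forall>d\<in>D. \<Phi> (generator d) = basis_vec [(0, d)])"

end

theory Submission
  imports Defs
begin

text \<open>
  In \<open>T(V, f)\<close> the iterated products of a letter \<open>x\<close> with \<open>n\<close> words (its symmetric braces) are
  \<open>f\<^sup>n(x)\<close> followed by the shuffle of these words. The morphism therefore has a closed form: the
  tree with root decoration \<open>d\<close> and forest of subtrees \<open>F\<close> is sent to the biletter \<open>(|F|, d)\<close>
  followed by the shuffle of the images of the trees in \<open>F\<close> (\<open>tree_words\<close>). This is multiplicative
  because right multiplication in \<open>T(V, f)\<close> is a derivation of the shuffle product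
  (\<open>shuffle_word_prod\<close>, \<open>sum_tree_words_graftings\<close>), and it is the only morphism with the given
  values on the generators (\<open>pre_lie_hom_unique\<close>).

  It is injective for a stronger reason: extend it to forests by shuffling the images of the
  trees; then even the images of distinct forests are linearly independent
  (\<open>forest_words_independent\<close>). Deleting a given first letter \<open>(k, d)\<close> is a derivation of the
  shuffle algebra. On forests it lifts to the derivation that replaces a tree with root
  decoration \<open>d\<close> and exactly \<open>k\<close> subtrees by the forest of these subtrees, so this derivation sends
  a linear relation between images of forests to another one, with fewer vertices. It remains to
  see that no nontrivial relation is killed by all of these derivations. The letter records the
  number \<open>k\<close> of subtrees, and this makes them triangular: if forests are compared by the multiset
  of the sizes of their trees, then in a maximal forest of the relation the removal of the root
  of a smallest tree gives a forest that arises from no other forest of the relation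
  (\<open>unroot_smallest_tree\<close>).

  The pre-Lie identity for trees is then read off from the one for words by injectivity.
\<close>

section \<open>Formal linear combinations\<close>

abbreviation coeff :: "('b \<Rightarrow>\<^sub>0 'k::zero) \<Rightarrow> 'b \<Rightarrow> 'k"
  where "coeff \<equiv> Poly_Mapping.lookup"

lemma coeff_pm_scale [simp]: "coeff (pm_scale c p) x = c * coeff p x"
  by (simp add: pm_scale_def Poly_Mapping.map.rep_eq when_def)

lemma coeff_basis_vec: "coeff (basis_vec y) x = (if x = y then 1 else 0)"
  by (auto simp: basis_vec_def lookup_single when_def)

interpretation pm: vector_space "pm_scale :: 'k::field \<Rightarrow> ('b \<Rightarrow>\<^sub>0 'k) \<Rightarrow> _"
  by unfold_locales (auto intro!: poly_mapping_eqI simp: lookup_add algebra_simps)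

lemma pm_eq_sum_basis: "p = (\<Sum>x\<in>Poly_Mapping.keys p. pm_scale (coeff p x) (basis_vec x))"
  by (rule poly_mapping_eqI)
    (auto simp: lookup_sum coeff_basis_vec if_distrib[of "(*) _"] in_keys_iff cong: if_cong)

lemma subspace_free_space: "pm.subspace (free_space B)"
proof -
  have "Poly_Mapping.keys (pm_scale c p) \<subseteq> Poly_Mapping.keys p" for c :: 'a and p :: "'b \<Rightarrow>\<^sub>0 'a"
    by (auto simp: in_keys_iff)
  then show ?thesis
    unfolding pm.subspace_def free_space_def
    by (auto dest!: subsetD[OF Poly_Mapping.keys_add] dest: subsetD)
qed

lemma basis_vec_in_free_space [simp]:
  "basis_vec x \<in> (free_space B :: ('b \<Rightarrow>\<^sub>0 'k::field) set) \<longleftrightarrow> x \<in> B"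
  by (simp add: free_space_def basis_vec_def)

lemma free_space_UNIV [simp]: "free_space UNIV = UNIV"
  by (simp add: free_space_def)

lemma free_space_induct [consumes 1, case_names zero step]:
  assumes p: "p \<in> free_space B"
    and zero: "P 0"
    and step: "\<And>c x q. x \<in> B \<Longrightarrow> q \<in> free_space B \<Longrightarrow> P q \<Longrightarrow> P (pm_scale c (basis_vec x) + q)"
  shows "P p"
proof -
  let ?s = "\<lambda>S. \<Sum>x\<in>S. pm_scale (coeff p x) (basis_vec x)"
  have "?s S \<in> free_space B \<and> P (?s S)" if "finite S" "S \<subseteq> B" for S
    using that
  proof (induction S)
    case empty
    then show ?case by (simp add: zero pm.subspace_0[OF subspace_free_space])
  next
    case (insert x S)
    then show ?case
      by (auto intro!: step pm.subspace_add[OF subspace_free_space]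
          pm.subspace_scale[OF subspace_free_space])
  qed
  from this[of "Poly_Mapping.keys p"] p show ?thesis
    by (simp add: free_space_def pm_eq_sum_basis[symmetric])
qed

lemmas pm_induct = free_space_induct[where B = UNIV, simplified, case_names zero step]

text \<open>Sums over multisets occur throughout, because the children of a vertex form a multiset;
  this is what lets a linear operation pass through them.\<close>

lemma additive_sum_mset:
  fixes f :: "'a::ab_group_add \<Rightarrow> 'b::ab_group_add"
  assumes "\<And>p q. f (p + q) = f p + f q"
  shows "f (\<Sum>x\<in>#M. g x) = (\<Sum>x\<in>#M. f (g x))"
proof -
  have "f 0 = 0" using assms[of 0 0] by simp
  then show ?thesis by (induction M) (simp_all add: assms)
qed

lemma lin_ext_superset:
  assumes "finite S" "Poly_Mapping.keys p \<subseteq> S"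
  shows "lin_ext g p = (\<Sum>x\<in>S. pm_scale (coeff p x) (g x))"
  unfolding lin_ext_def using assms
  by (intro sum.mono_neutral_left) (auto simp: in_keys_iff)

lemma lin_ext_zero [simp]: "lin_ext g 0 = 0"
  by (simp add: lin_ext_def)

lemma lin_ext_add: "lin_ext g (p + q) = lin_ext g p + lin_ext g q"
proof -
  let ?S = "Poly_Mapping.keys p \<union> Poly_Mapping.keys q"
  have "lin_ext g (p + q) = (\<Sum>x\<in>?S. pm_scale (coeff (p + q) x) (g x))"
    by (intro lin_ext_superset) (auto dest: subsetD[OF Poly_Mapping.keys_add])
  also have "\<dots> = lin_ext g p + lin_ext g q"
    by (simp add: lin_ext_superset[of ?S] lookup_add pm.scale_left_distrib sum.distrib)
  finally show ?thesis .
qed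

lemma lin_ext_scale: "lin_ext g (pm_scale c p) = pm_scale c (lin_ext g p)"
  by (subst lin_ext_superset[of "Poly_Mapping.keys p"])
    (auto simp: in_keys_iff lin_ext_def pm.scale_sum_right)

lemma lin_ext_basis [simp]: "lin_ext g (basis_vec x) = g x"
  by (simp add: lin_ext_def basis_vec_def)

lemma lin_ext_fun_add: "lin_ext (\<lambda>x. g x + h x) p = lin_ext g p + lin_ext h p"
  by (simp add: lin_ext_def pm.scale_right_distrib sum.distrib)

lemma lin_ext_fun_scale: "lin_ext (\<lambda>x. pm_scale c (g x)) p = pm_scale c (lin_ext g p)"
  by (simp add: lin_ext_def pm.scale_sum_right mult.commute)

lemma lin_ext_fun_zero: "lin_ext (\<lambda>x. 0) p = 0"
  by (simp add: lin_ext_def)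

lemma coeff_lin_ext:
  "coeff (lin_ext g p) y = (\<Sum>x\<in>Poly_Mapping.keys p. coeff p x * coeff (g x) y)"
  by (simp add: lin_ext_def lookup_sum)

lemma lin_ext_in_subspace:
  assumes "p \<in> free_space B" "pm.subspace A" "\<And>x. x \<in> B \<Longrightarrow> g x \<in> A"
  shows "lin_ext g p \<in> A"
  unfolding lin_ext_def using assms
  by (auto simp: free_space_def intro!: pm.subspace_sum pm.subspace_scale)

lemma bilin_ext_in_subspace:
  assumes "p \<in> free_space B" "q \<in> free_space C" "pm.subspace A"
    and "\<And>x y. x \<in> B \<Longrightarrow> y \<in> C \<Longrightarrow> g x y \<in> A"
  shows "bilin_ext g p q \<in> A"
  unfolding bilin_ext_def using assms by (blast intro: lin_ext_in_subspace)

lemmas bilin_ext_linear =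
  bilin_ext_def lin_ext_add lin_ext_scale lin_ext_fun_add lin_ext_fun_scale lin_ext_fun_zero

lemma letter_concat_linear [simp]:
  "letter_concat 0 p = 0" "letter_concat v 0 = 0"
  "letter_concat (u + v) p = letter_concat u p + letter_concat v p"
  "letter_concat v (p + q) = letter_concat v p + letter_concat v q"
  "letter_concat (pm_scale c v) p = pm_scale c (letter_concat v p)"
  "letter_concat v (pm_scale c p) = pm_scale c (letter_concat v p)"
  "letter_concat (basis_vec x) (basis_vec w) = basis_vec (x # w)"
  by (simp_all add: letter_concat_def bilin_ext_linear)

lemma shuffle_linear [simp]:
  "shuffle 0 p = 0" "shuffle p 0 = 0"
  "shuffle (p + q) r = shuffle p r + shuffle q r"
  "shuffle p (q + r) = shuffle p q + shuffle p r"
  "shuffle (pm_scale c p) q = pm_scale c (shuffle p q)"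
  "shuffle p (pm_scale c q) = pm_scale c (shuffle p q)"
  "shuffle (basis_vec u) (basis_vec v) = shuffle_words u v"
  by (simp_all add: shuffle_def bilin_ext_linear)

lemma tensor_prod_linear [simp]:
  "tensor_prod f 0 p = 0" "tensor_prod f p 0 = 0"
  "tensor_prod f (p + q) r = tensor_prod f p r + tensor_prod f q r"
  "tensor_prod f p (q + r) = tensor_prod f p q + tensor_prod f p r"
  "tensor_prod f (pm_scale c p) q = pm_scale c (tensor_prod f p q)"
  "tensor_prod f p (pm_scale c q) = pm_scale c (tensor_prod f p q)"
  "tensor_prod f (basis_vec u) (basis_vec v) = tensor_prod_words f u v"
  by (simp_all add: tensor_prod_def bilin_ext_linear)

lemma tree_prod_linear [simp]:
  "tree_prod 0 p = 0" "tree_prod p 0 = 0"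
  "tree_prod (p + q) r = tree_prod p r + tree_prod q r"
  "tree_prod p (q + r) = tree_prod p q + tree_prod p r"
  "tree_prod (pm_scale c p) q = pm_scale c (tree_prod p q)"
  "tree_prod p (pm_scale c q) = pm_scale c (tree_prod p q)"
  "tree_prod (basis_vec s) (basis_vec t) = (\<Sum>u\<in>#graftings s t. basis_vec u)"
  by (simp_all add: tree_prod_def bilin_ext_linear)

lemma f_biletter_basis_vec [simp]: "f_biletter (basis_vec (k, d)) = basis_vec (Suc k, d)"
  by (simp add: f_biletter_def)

section \<open>Residuals of elements of the tensor space\<close>

text \<open>The left quotient by the letter \<open>x\<close>: words not starting with \<open>x\<close> are sent to \<open>0\<close>, and \<open>x\<close> is
  deleted from the others.\<close>

definition residual :: "'b \<Rightarrow> ('b list \<Rightarrow>\<^sub>0 'k) \<Rightarrow> ('b list \<Rightarrow>\<^sub>0 'k::field)"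
  where "residual x = Poly_Mapping.map_key (Cons x)"

lemma coeff_residual: "coeff (residual x p) w = coeff p (x # w)"
  by (simp add: residual_def map_key.rep_eq)

lemma residual_linear [simp]:
  "residual x 0 = 0"
  "residual x (p + q) = residual x p + residual x q"
  "residual x (p - q) = residual x p - residual x q"
  "residual x (pm_scale c p) = pm_scale c (residual x p)"
  by (auto intro!: poly_mapping_eqI simp: coeff_residual lookup_add lookup_minus)

lemma residual_basis_vec [simp]:
  "residual x (basis_vec []) = 0"
  "residual x (basis_vec (y # w)) = (if x = y then basis_vec w else 0)"
  by (auto intro!: poly_mapping_eqI simp: coeff_residual coeff_basis_vec)

lemma residual_letter_concat [simp]:
  "residual x (letter_concat v p) = pm_scale (coeff v x) p"
proof (induction v rule: pm_induct)
  case (step c y v)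
  have "residual x (letter_concat (basis_vec y) p) = pm_scale (coeff (basis_vec y) x) p"
    by (induction p rule: pm_induct) (auto simp: coeff_basis_vec pm.scale_right_distrib)
  with step show ?case by (simp add: lookup_add pm.scale_left_distrib)
qed simp

lemma coeff_letter_concat_Nil [simp]: "coeff (letter_concat v p) [] = 0"
proof (induction v rule: pm_induct)
  case (step c y v)
  have "coeff (letter_concat (basis_vec y) p) [] = 0"
    by (induction p rule: pm_induct) (auto simp: coeff_basis_vec lookup_add)
  with step show ?case by (simp add: lookup_add)
qed simp

lemma shuffle_unit [simp]:
  fixes p :: "'b list \<Rightarrow>\<^sub>0 'k::field"
  shows "shuffle (basis_vec []) p = p" "shuffle p (basis_vec []) = p"
proof -
  have "shuffle_words w [] = (basis_vec w :: _ \<Rightarrow>\<^sub>0 'k)" for w :: "'b list"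
    by (cases w) simp_all
  then show "shuffle p (basis_vec []) = p"
    by (induction p rule: pm_induct) simp_all
  show "shuffle (basis_vec []) p = p"
    by (induction p rule: pm_induct) simp_all
qed

text \<open>The first letter of a shuffle comes from exactly one of the two factors. Hence residuals are
  derivations of the shuffle algebra, and an identity between multilinear expressions can be
  checked one coefficient at a time, by induction on the word at which the coefficient is taken:
  residuals shorten that word, and the empty word is trivial. Commutativity, associativity and
  the two identities for the pre-Lie product are all proved in this way.\<close>

lemma residual_shuffle [simp]:
  fixes p q :: "'b list \<Rightarrow>\<^sub>0 'k::field"
  shows "residual x (shuffle p q) = shuffle (residual x p) q + shuffle p (residual x q)"
proof -
  have words: "residual x (shuffle_words u v) =
      shuffle (residual x (basis_vec u)) (basis_vec v) +
      shuffle (basis_vec u) (residual x (basis_vec v :: _ \<Rightarrow>\<^sub>0 'k))" for u v :: "'b list"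
    by (cases "(u, v)" rule: shuffle_words.cases) (auto simp: coeff_basis_vec)
  have "residual x (shuffle (basis_vec u) q) =
      shuffle (residual x (basis_vec u)) q + shuffle (basis_vec u) (residual x q)" for u
    by (induction q rule: pm_induct) (simp_all add: words algebra_simps pm.scale_right_distrib)
  then show ?thesis
    by (induction p rule: pm_induct) (simp_all add: algebra_simps pm.scale_right_distrib)
qed

lemma coeff_shuffle_Nil [simp]:
  fixes p q :: "'b list \<Rightarrow>\<^sub>0 'k::field"
  shows "coeff (shuffle p q) [] = coeff p [] * coeff q []"
proof -
  have words: "coeff (shuffle_words u v) [] =
      coeff (basis_vec u) [] * coeff (basis_vec v :: _ \<Rightarrow>\<^sub>0 'k) []" for u v :: "'b list"
    by (cases "(u, v)" rule: shuffle_words.cases) (auto simp: coeff_basis_vec lookup_add)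
  have "coeff (shuffle (basis_vec u) q) [] = coeff (basis_vec u) [] * coeff q []" for u
    by (induction q rule: pm_induct) (simp_all add: words lookup_add algebra_simps)
  then show ?thesis
    by (induction p rule: pm_induct) (simp_all add: lookup_add algebra_simps)
qed

lemma shuffle_commute: "shuffle p q = shuffle q p"
proof (rule poly_mapping_eqI)
  fix w show "coeff (shuffle p q) w = coeff (shuffle q p) w"
    by (induction w arbitrary: p q)
      (simp_all add: coeff_residual[symmetric] lookup_add mult.commute add.commute)
qed

lemma shuffle_assoc: "shuffle (shuffle p q) r = shuffle p (shuffle q r)"
proof (rule poly_mapping_eqI)
  fix w show "coeff (shuffle (shuffle p q) r) w = coeff (shuffle p (shuffle q r)) w"
    by (induction w arbitrary: p q r) (simp_all add: coeff_residual[symmetric] lookup_add)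
qed

lemma shuffle_left_commute: "shuffle p (shuffle q r) = shuffle q (shuffle p r)"
  by (metis shuffle_assoc shuffle_commute)

lemmas shuffle_ac = shuffle_assoc shuffle_commute shuffle_left_commute

section \<open>The pre-Lie product of words\<close>

abbreviation word_prod ::
    "((nat \<times> 'd) list \<Rightarrow>\<^sub>0 'k) \<Rightarrow> ((nat \<times> 'd) list \<Rightarrow>\<^sub>0 'k) \<Rightarrow> ((nat \<times> 'd) list \<Rightarrow>\<^sub>0 'k::field)"
    (infixl "\<bullet>" 70)
  where "word_prod \<equiv> tensor_prod f_biletter"

text \<open>As \<open>f_biletter\<close> raises the number of a biletter by one, the term \<open>f(x)(w \<squnion> w')\<close> of a product
  starts with \<open>(k, d)\<close> when its left factor starts with \<open>(k - 1, d)\<close>, and never for \<open>k = 0\<close>.\<close>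

fun lowered_residual ::
    "nat \<times> 'd \<Rightarrow> ((nat \<times> 'd) list \<Rightarrow>\<^sub>0 'k) \<Rightarrow> ((nat \<times> 'd) list \<Rightarrow>\<^sub>0 'k::field)" where
  "lowered_residual (0, d) p = 0"
| "lowered_residual (Suc k, d) p = residual (k, d) p"

lemma lowered_residual_linear [simp]:
  "lowered_residual x 0 = 0"
  "lowered_residual x (p + q) = lowered_residual x p + lowered_residual x q"
  "lowered_residual x (pm_scale c p) = pm_scale c (lowered_residual x p)"
  "lowered_residual x (shuffle p q) =
     shuffle (lowered_residual x p) q + shuffle p (lowered_residual x q)"
  by (cases "(x, p)" rule: lowered_residual.cases; simp)+

lemma residual_word_prod [simp]:
  fixes p q :: "(nat \<times> 'd) list \<Rightarrow>\<^sub>0 'k::field"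
  shows "residual x (p \<bullet> q) = residual x p \<bullet> q + shuffle (lowered_residual x p) q"
proof -
  have words: "residual x (tensor_prod_words f_biletter u v) =
      residual x (basis_vec u) \<bullet> basis_vec v +
      shuffle (lowered_residual x (basis_vec u)) (basis_vec v)" for u v
  proof (cases u)
    case (Cons y w)
    obtain k d where y: "y = (k, d)" by (cases y)
    show ?thesis
      by (cases "(x, basis_vec u :: _ \<Rightarrow>\<^sub>0 'k)" rule: lowered_residual.cases)
        (auto simp: Cons y coeff_basis_vec)
  next
    case Nil
    then show ?thesis
      by (cases "(x, basis_vec u :: _ \<Rightarrow>\<^sub>0 'k)" rule: lowered_residual.cases) auto
  qed
  have "residual x (basis_vec u \<bullet> q) =
      residual x (basis_vec u) \<bullet> q + shuffle (lowered_residual x (basis_vec u)) q" for u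
    by (induction q rule: pm_induct) (simp_all add: words algebra_simps pm.scale_right_distrib)
  then show ?thesis
    by (induction p rule: pm_induct) (simp_all add: algebra_simps pm.scale_right_distrib)
qed

lemma coeff_word_prod_Nil [simp]:
  fixes p q :: "(nat \<times> 'd) list \<Rightarrow>\<^sub>0 'k::field"
  shows "coeff (p \<bullet> q) [] = 0"
proof -
  have words: "coeff (tensor_prod_words f_biletter u v :: _ \<Rightarrow>\<^sub>0 'k) [] = 0"
    for u v :: "(nat \<times> 'd) list"
    by (cases u) (auto simp: lookup_add)
  have "coeff (basis_vec u \<bullet> q) [] = 0" for u
    by (induction q rule: pm_induct) (simp_all add: words lookup_add)
  then show ?thesis
    by (induction p rule: pm_induct) (simp_all add: lookup_add)
qed

lemma unit_word_prod [simp]: "basis_vec [] \<bullet> q = 0"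
  by (induction q rule: pm_induct) simp_all

text \<open>Right multiplication by \<open>r\<close> is a derivation of the shuffle algebra: with this, words form a
  Com-pre-Lie algebra. It gives both the pre-Lie identity and the value of the product on a
  shuffle of trees.\<close>

lemma shuffle_word_prod: "shuffle p q \<bullet> r = shuffle (p \<bullet> r) q + shuffle p (q \<bullet> r)"
proof (rule poly_mapping_eqI)
  fix w show "coeff (shuffle p q \<bullet> r) w = coeff (shuffle (p \<bullet> r) q + shuffle p (q \<bullet> r)) w"
  proof (induction w arbitrary: p q)
    case Nil
    show ?case by (simp add: lookup_add)
  next
    case (Cons x w)
    then show ?case
      by (simp add: coeff_residual[symmetric] lookup_add shuffle_ac add_ac)
  qed
qed

text \<open>The pre-Lie identity needs \<open>s\<close> only as something independent of \<open>q\<close>; it is the result of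
  lowering twice.\<close>

lemma lowered_residual_word_prod:
  obtains s where "\<And>q. lowered_residual x (p \<bullet> q) = lowered_residual x p \<bullet> q + shuffle s q"
proof (cases "(x, p)" rule: lowered_residual.cases)
  case (1 d p')
  then show ?thesis using that[of 0] by simp
next
  case (2 k d p')
  then show ?thesis using that[of "lowered_residual (k, d) p"] by simp
qed

text \<open>By induction, everything in the residual of the associator of \<open>p\<close>, \<open>q\<close>, \<open>r\<close> that is not
  itself an associator is visibly symmetric in \<open>q\<close> and \<open>r\<close>.\<close>

lemma word_prod_pre_lie: "(p \<bullet> q) \<bullet> r - p \<bullet> (q \<bullet> r) = (p \<bullet> r) \<bullet> q - p \<bullet> (r \<bullet> q)"
proof (rule poly_mapping_eqI)
  fix w show "coeff ((p \<bullet> q) \<bullet> r - p \<bullet> (q \<bullet> r)) w = coeff ((p \<bullet> r) \<bullet> q - p \<bullet> (r \<bullet> q)) w"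
  proof (induction w arbitrary: p)
    case Nil
    show ?case by (simp add: lookup_minus)
  next
    case (Cons x w)
    let ?e = "lowered_residual x p"
    obtain s where s: "\<And>q. lowered_residual x (p \<bullet> q) = ?e \<bullet> q + shuffle s q"
      using lowered_residual_word_prod by blast
    have "residual x ((p \<bullet> q) \<bullet> r - p \<bullet> (q \<bullet> r)) =
        ((residual x p \<bullet> q) \<bullet> r - residual x p \<bullet> (q \<bullet> r)) +
        (shuffle (?e \<bullet> q) r + shuffle (?e \<bullet> r) q + shuffle s (shuffle q r))" for q r
      by (simp add: s shuffle_word_prod shuffle_assoc algebra_simps)
    with Cons[of "residual x p"] show ?case
      by (simp add: coeff_residual[symmetric] lookup_add lookup_minus shuffle_commute[of q r]
          del: residual_linear residual_word_prod)
  qed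
qed

section \<open>Linear extensions of decorated forests\<close>

definition shuffle_prod :: "('b list \<Rightarrow>\<^sub>0 'k) multiset \<Rightarrow> ('b list \<Rightarrow>\<^sub>0 'k::field)"
  where "shuffle_prod M = fold_mset shuffle (basis_vec []) M"

lemma comp_fun_commute_shuffle: "comp_fun_commute shuffle"
  by unfold_locales (auto simp: shuffle_left_commute)

lemma shuffle_prod_empty [simp]: "shuffle_prod {#} = basis_vec []"
  by (simp add: shuffle_prod_def)

lemma shuffle_prod_add_mset [simp]: "shuffle_prod (add_mset p M) = shuffle p (shuffle_prod M)"
  by (simp add: shuffle_prod_def comp_fun_commute.fold_mset_add_mset[OF comp_fun_commute_shuffle])

lemma shuffle_prod_union: "shuffle_prod (M + N) = shuffle (shuffle_prod M) (shuffle_prod N)"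
  by (induction M) (simp_all add: shuffle_assoc)

text \<open>There are two derivations of interest: taking residuals, and right multiplication in the
  pre-Lie algebra of words.\<close>

lemma derivation_shuffle_prod:
  assumes leibniz: "\<And>p q. \<delta> (shuffle p q) = shuffle (\<delta> p) q + shuffle p (\<delta> q)"
    and unit: "\<delta> (basis_vec []) = 0"
  shows "\<delta> (shuffle_prod (image_mset f F)) =
    (\<Sum>t\<in>#F. shuffle (shuffle_prod (image_mset f (F - {#t#}))) (\<delta> (f t)))"
proof (induction F)
  case empty
  show ?case by (simp add: unit)
next
  case (add u F)
  have "(\<Sum>t\<in>#F. shuffle (shuffle_prod (image_mset f (add_mset u F - {#t#}))) (\<delta> (f t))) =
      (\<Sum>t\<in>#F. shuffle (f u) (shuffle (shuffle_prod (image_mset f (F - {#t#}))) (\<delta> (f t))))"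
    by (intro arg_cong[where f = sum_mset] image_mset_cong) (simp add: shuffle_assoc)
  also have "\<dots> = shuffle (f u) (\<delta> (shuffle_prod (image_mset f F)))"
    unfolding add.IH by (subst additive_sum_mset[where f = "shuffle (f u)"]) simp_all
  finally show ?case
    by (simp add: leibniz shuffle_commute)
qed

text \<open>The sum, over all linear extensions of the tree (ancestors first), of the word that lists
  the vertices in this order, each as a biletter made of its number of children and its
  decoration.\<close>

primrec tree_words :: "'d rtree \<Rightarrow> ((nat \<times> 'd) list \<Rightarrow>\<^sub>0 'k::field)" where
  "tree_words (Node d F) =
     letter_concat (basis_vec (size F, d)) (shuffle_prod (image_mset tree_words F))"

definition forest_words :: "'d rtree multiset \<Rightarrow> ((nat \<times> 'd) list \<Rightarrow>\<^sub>0 'k::field)"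
  where "forest_words F = shuffle_prod (image_mset tree_words F)"

fun root_letter :: "'d rtree \<Rightarrow> nat \<times> 'd" where
  "root_letter (Node d F) = (size F, d)"

fun children :: "'d rtree \<Rightarrow> 'd rtree multiset" where
  "children (Node d F) = F"

primrec vertices :: "'d rtree \<Rightarrow> nat" where
  "vertices (Node d F) = Suc (\<Sum>\<^sub># (image_mset vertices F))"

lemma tree_words_eq:
  "tree_words t = letter_concat (basis_vec (root_letter t)) (forest_words (children t))"
  by (cases t) (simp add: forest_words_def)

lemma rtree_eqI: "root_letter s = root_letter t \<Longrightarrow> children s = children t \<Longrightarrow> s = t"
  by (cases s; cases t) simp

lemma size_children: "size (children t) = fst (root_letter t)"
  by (cases t) simp

lemma vertices_children: "vertices t = Suc (\<Sum>\<^sub># (image_mset vertices (children t)))"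
  by (cases t) simp

lemma vertices_pos: "vertices t > 0"
  by (cases t) simp

lemma vertices_child_less: "s \<in># children t \<Longrightarrow> vertices s < vertices t"
  by (auto simp: vertices_children[of t] less_Suc_eq_le dest!: multi_member_split)

lemma forest_words_empty [simp]: "forest_words {#} = basis_vec []"
  by (simp add: forest_words_def)

lemma forest_words_union: "forest_words (F + G) = shuffle (forest_words F) (forest_words G)"
  by (simp add: forest_words_def shuffle_prod_union)

lemma forest_words_single [simp]: "forest_words {#t#} = tree_words t"
  by (simp add: forest_words_def)

lemma coeff_forest_words_Nil: "coeff (forest_words F) [] = (if F = {#} then 1 else 0)"
  by (cases F) (auto simp: forest_words_def tree_words_eq coeff_basis_vec)

text \<open>As \<open>F\<close> ranges over the monomials of the polynomial algebra on trees, this is the derivation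
  that replaces a tree by the product of its children if its root carries the biletter \<open>x\<close>, and
  by \<open>0\<close> otherwise. In terms of linear extensions, it removes the first vertex when this vertex
  carries \<open>x\<close>, so it corresponds to the residual on words.\<close>

definition unroot :: "nat \<times> 'd \<Rightarrow> 'd rtree multiset \<Rightarrow> ('d rtree multiset \<Rightarrow>\<^sub>0 'k::field)"
  where "unroot x F =
    (\<Sum>t\<in>#F. if root_letter t = x then basis_vec (F - {#t#} + children t) else 0)"

lemma residual_forest_words: "residual x (forest_words F) = lin_ext forest_words (unroot x F)"
proof -
  have "residual x (forest_words F) =
      (\<Sum>t\<in>#F. shuffle (forest_words (F - {#t#})) (residual x (tree_words t)))"
    unfolding forest_words_def by (rule derivation_shuffle_prod) simp_all
  also have "\<dots> = (\<Sum>t\<in>#F. lin_ext forest_words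
      (if root_letter t = x then basis_vec (F - {#t#} + children t) else 0))"
    by (intro arg_cong[where f = sum_mset] image_mset_cong)
      (auto simp: tree_words_eq coeff_basis_vec simp flip: forest_words_union)
  also have "\<dots> = lin_ext forest_words (unroot x F)"
    unfolding unroot_def by (subst additive_sum_mset[where f = "lin_ext forest_words"])
      (simp_all add: lin_ext_add)
  finally show ?thesis .
qed

lemma residual_lin_ext_forest_words:
  "residual x (lin_ext forest_words P) = lin_ext forest_words (lin_ext (unroot x) P)"
  by (induction P rule: pm_induct)
    (simp_all add: lin_ext_add lin_ext_scale residual_forest_words)

section \<open>Linear independence of the forests\<close>

lemma coeff_unroot:
  "coeff (unroot x F) G =
    (\<Sum>t\<in>#F. if root_letter t = x \<and> F - {#t#} + children t = G then 1 else 0)"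
  unfolding unroot_def
  by (subst additive_sum_mset[where f = "\<lambda>p. coeff p G"])
    (auto simp: lookup_add coeff_basis_vec intro!: arg_cong[where f = sum_mset] image_mset_cong)

lemma unroot_nonzeroE:
  assumes "coeff (unroot x F) G \<noteq> 0"
  obtains (witness) t where "t \<in># F" "root_letter t = x" "F - {#t#} + children t = G"
proof -
  have "coeff (unroot x F) G = (\<Sum>t\<in>#F. 0)" if "\<not> thesis"
    unfolding coeff_unroot
    by (intro arg_cong[where f = sum_mset] image_mset_cong) (use that in \<open>auto intro: witness\<close>)
  with assms show thesis by auto
qed

text \<open>The triangularity behind the linear independence. Let \<open>t\<close> be a smallest tree of \<open>F\<close>, and
  let unrooting \<open>t\<close> in \<open>F\<close> give the same forest as unrooting \<open>t'\<close> in \<open>F'\<close>, the two roots carrying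
  the same biletter. As the biletter records the number of children, \<open>t\<close> and \<open>t'\<close> have equally
  many of them. So if the children differ, one of the children of \<open>t'\<close> is one of the remaining
  trees of \<open>F\<close>, hence at least as large as \<open>t\<close>, and \<open>t'\<close> is larger than \<open>t\<close>. Going from \<open>F\<close> to \<open>F'\<close> then
  trades \<open>t\<close> and some children of \<open>t'\<close> for \<open>t'\<close> and some children of \<open>t\<close>. This increases the
  multiset of sizes, as \<open>t'\<close> is larger than everything given up.\<close>

lemma unroot_smallest_tree:
  assumes t: "t \<in># F" and smallest: "\<And>s. s \<in># F \<Longrightarrow> vertices t \<le> vertices s"
    and t': "t' \<in># F'" and root: "root_letter t' = root_letter t"
    and eq: "F' - {#t'#} + children t' = F - {#t#} + children t"
  shows "t' = t \<and> F' = F \<or> image_mset vertices F < image_mset vertices F'"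
proof (cases "children t' = children t")
  case True
  with root have "t' = t" by (intro rtree_eqI) simp_all
  moreover from eq True t t' have "F' = F"
    by (metis add_right_cancel insert_DiffM calculation)
  ultimately show ?thesis by simp
next
  case False
  \<comment> \<open>\<open>F\<close> is \<open>t\<close>, \<open>A\<close> and \<open>H - A\<close>; unrooting \<open>t\<close> and regrouping \<open>I\<close> and \<open>A\<close> below \<open>t'\<close> gives
    \<open>F'\<close>, that is \<open>t'\<close>, \<open>B\<close> and \<open>H - A\<close>.\<close>
  define H where "H = F - {#t#}"
  define A where "A = children t' - children t"
  define B where "B = children t - children t'"
  define I where "I = children t \<inter># children t'"
  have C: "children t = I + B" "children t' = I + A"
    unfolding I_def A_def B_def
    by (auto simp: multiset_eq_iff)
  have H': "F' - {#t'#} + A = H + B"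
    using eq unfolding H_def[symmetric] C by (simp add: ac_simps)
  have "size A = size B"
    using arg_cong[OF root, of fst] unfolding size_children[symmetric] C by simp
  with False C have "A \<noteq> {#}" by auto
  have "A \<inter># B = {#}"
    unfolding A_def B_def by (auto simp: multiset_eq_iff)
  have "A \<subseteq># H"
    unfolding subseteq_mset_def
  proof
    fix s
    have "count (F' - {#t'#}) s + count A s = count H s + count B s"
      using arg_cong[OF H', of "\<lambda>M. count M s"] by simp
    moreover have "min (count A s) (count B s) = 0"
      using arg_cong[OF \<open>A \<inter># B = {#}\<close>, of "\<lambda>M. count M s"] by simp
    ultimately show "count A s \<le> count H s" by linarith
  qed
  then have H: "H = (H - A) + A" by simp
  have F: "F = (H - A) + add_mset t A"
    using t H by (metis H_def insert_DiffM union_mset_add_mset_right)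
  have "F' - {#t'#} = (H - A) + B"
    using H' H by (metis add.assoc add.commute add_right_cancel)
  then have F': "F' = (H - A) + add_mset t' B"
    using t' by (metis insert_DiffM union_mset_add_mset_right)
  have A_less: "vertices a < vertices t'" if "a \<in># A" for a
    using that C by (intro vertices_child_less) simp
  obtain a where "a \<in># A" using \<open>A \<noteq> {#}\<close> by blast
  have "vertices t \<le> vertices a"
    using \<open>a \<in># A\<close> F by (intro smallest) simp
  also note A_less[OF \<open>a \<in># A\<close>]
  finally have "vertices t < vertices t'" .
  then have "image_mset vertices F < image_mset vertices F'"
    unfolding F F' less_multiset_def image_mset_union
    by (intro one_step_implies_multp) (auto dest: A_less)
  then show ?thesis ..
qed

text \<open>By induction on the number of vertices. In a nontrivial relation \<open>P\<close>, take a forest \<open>F\<close> of \<open>P\<close> whose multiset of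
  sizes is maximal, and unroot with the root biletter \<open>x\<close> of a smallest tree \<open>t\<close> of \<open>F\<close>. The
  result is again a relation, on forests with fewer vertices, so it vanishes. But by
  \<open>unroot_smallest_tree\<close> its coefficient at \<open>F\<close> with \<open>t\<close> unrooted is the coefficient of \<open>F\<close> in
  \<open>P\<close> times the multiplicity of \<open>t\<close> in \<open>F\<close>, which is nonzero in characteristic zero.\<close>

theorem forest_words_independent:
  fixes P :: "'d rtree multiset \<Rightarrow>\<^sub>0 'k::field_char_0"
  assumes "lin_ext forest_words P = (0 :: _ \<Rightarrow>\<^sub>0 'k)"
  shows "P = 0"
proof -
  define weight :: "'d rtree multiset \<Rightarrow> nat" where "weight F = (\<Sum>t\<in>#F. vertices t)" for F
  have "P = 0"
    if "\<forall>F\<in>Poly_Mapping.keys P. weight F < n" "lin_ext forest_words P = (0 :: _ \<Rightarrow>\<^sub>0 'k)"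
    for n and P :: "'d rtree multiset \<Rightarrow>\<^sub>0 'k"
    using that
  proof (induction n arbitrary: P)
    case 0
    then show ?case by simp
  next
    case (Suc n)
    show ?case
    proof (rule ccontr)
      assume "P \<noteq> 0"
      then obtain F where F: "F \<in> Poly_Mapping.keys P"
        and maximal: "\<And>F'. F' \<in> Poly_Mapping.keys P \<Longrightarrow>
          \<not> image_mset vertices F < image_mset vertices F'"
        using finite_has_maximal[of "image_mset vertices ` Poly_Mapping.keys P"]
        by (auto simp: less_le)
      \<comment> \<open>Only the empty forest contributes to the empty word, so it does not occur in \<open>P\<close>, and
        \<open>F\<close> has a tree to unroot.\<close>
      have "0 = coeff (lin_ext forest_words P :: _ \<Rightarrow>\<^sub>0 'k) []"
        using Suc.prems by simp
      also have "\<dots> = coeff P {#}"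
        by (simp add: coeff_lin_ext coeff_forest_words_Nil if_distrib[of "(*) _"] in_keys_iff
            cong: if_cong)
      finally have "F \<noteq> {#}" using F by (auto simp: in_keys_iff)
      then obtain t where t: "t \<in># F" and smallest: "\<And>s. s \<in># F \<Longrightarrow> vertices t \<le> vertices s"
        using ex_has_least_nat[of "\<lambda>s. s \<in># F" _ vertices] by (metis multiset_nonemptyE)
      define x where "x = root_letter t"
      define G where "G = F - {#t#} + children t"
      have unroot_F: "coeff (unroot x F :: _ \<Rightarrow>\<^sub>0 'k) G = of_nat (count F t)"
      proof -
        have "root_letter s = x \<and> F - {#s#} + children s = G \<longleftrightarrow> s = t" if "s \<in># F" for s
          using unroot_smallest_tree[OF t smallest that] by (auto simp: x_def G_def)
        then have "coeff (unroot x F :: _ \<Rightarrow>\<^sub>0 'k) G = (\<Sum>s\<in>#F. if s = t then 1 else 0)"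
          unfolding coeff_unroot by (intro arg_cong[where f = sum_mset] image_mset_cong) simp
        then show ?thesis by (simp add: sum_mset_delta)
      qed
      have unroot_other: "coeff (unroot x F' :: _ \<Rightarrow>\<^sub>0 'k) G = 0"
        if "F' \<in> Poly_Mapping.keys P" "F' \<noteq> F" for F'
      proof (rule ccontr)
        assume "coeff (unroot x F' :: _ \<Rightarrow>\<^sub>0 'k) G \<noteq> 0"
        then obtain s where "s \<in># F'" "root_letter s = x" "F' - {#s#} + children s = G"
          by (rule unroot_nonzeroE)
        then show False
          using unroot_smallest_tree[OF t smallest \<open>s \<in># F'\<close>] maximal \<open>F' \<in> _\<close> \<open>F' \<noteq> F\<close>
          by (auto simp: x_def G_def)
      qed
      have "coeff (lin_ext (unroot x) P) G = coeff P F * of_nat (count F t)"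
        unfolding coeff_lin_ext
        using F by (subst sum.remove[of _ F]) (auto simp: unroot_F unroot_other)
      also have "\<dots> \<noteq> 0" using F t by (simp add: in_keys_iff)
      finally have "lin_ext (unroot x) P \<noteq> (0 :: _ \<Rightarrow>\<^sub>0 'k)" by auto
      moreover have "lin_ext (unroot x) P = (0 :: _ \<Rightarrow>\<^sub>0 'k)"
      proof (rule Suc.IH)
        show "lin_ext forest_words (lin_ext (unroot x) P) = (0 :: _ \<Rightarrow>\<^sub>0 'k)"
          unfolding residual_lin_ext_forest_words[symmetric] Suc.prems(2) by simp
        show "\<forall>G\<in>Poly_Mapping.keys (lin_ext (unroot x) P :: _ \<Rightarrow>\<^sub>0 'k). weight G < n"
        proof
          fix G assume "G \<in> Poly_Mapping.keys (lin_ext (unroot x) P :: _ \<Rightarrow>\<^sub>0 'k)"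
          then obtain F where "F \<in> Poly_Mapping.keys P" "coeff (unroot x F :: _ \<Rightarrow>\<^sub>0 'k) G \<noteq> 0"
            unfolding in_keys_iff coeff_lin_ext
            by (auto elim!: sum.not_neutral_contains_not_neutral simp: in_keys_iff)
          moreover from this(2) obtain s where "s \<in># F" "F - {#s#} + children s = G"
            by (rule unroot_nonzeroE)
          ultimately show "weight G < n"
            using Suc.prems(1)
            by (auto simp: weight_def vertices_children[of s] dest!: multi_member_split)
        qed
      qed
      ultimately show False by contradiction
    qed
  qed
  moreover obtain n where "\<forall>F\<in>Poly_Mapping.keys P. weight F < n"
    using finite_nat_set_iff_bounded[of "weight ` Poly_Mapping.keys P"] by auto
  ultimately show ?thesis using assms by blast
qed

lemma tree_words_independent:
  fixes p :: "'d rtree \<Rightarrow>\<^sub>0 'k::field_char_0"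
  assumes "lin_ext tree_words p = (0 :: _ \<Rightarrow>\<^sub>0 'k)"
  shows "p = 0"
proof -
  let ?P = "lin_ext (\<lambda>t. basis_vec {#t#}) p :: _ \<Rightarrow>\<^sub>0 'k"
  have "lin_ext forest_words ?P = (lin_ext tree_words p :: _ \<Rightarrow>\<^sub>0 'k)"
    by (induction p rule: pm_induct) (simp_all add: lin_ext_add lin_ext_scale)
  with assms have "?P = 0" by (intro forest_words_independent) simp
  moreover have "coeff ?P {#t#} = coeff p t" for t
    by (simp add: coeff_lin_ext coeff_basis_vec if_distrib[of "(*) _"] in_keys_iff cong: if_cong)
  ultimately show ?thesis
    by (intro poly_mapping_eqI) (metis lookup_zero)
qed

section \<open>The morphism\<close>

lemma lin_ext_diff: "lin_ext g (p - q) = lin_ext g p - lin_ext g q"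
  using lin_ext_add[of g "p - q" q] by simp

lemma lin_ext_tree_words_inject:
  fixes p q :: "'d rtree \<Rightarrow>\<^sub>0 'k::field_char_0"
  assumes "lin_ext tree_words p = (lin_ext tree_words q :: _ \<Rightarrow>\<^sub>0 'k)"
  shows "p = q"
  using tree_words_independent[of "p - q"] assms by (simp add: lin_ext_diff)

lemma letter_concat_word_prod:
  "letter_concat (basis_vec (k, d)) p \<bullet> q =
     letter_concat (basis_vec (k, d)) (p \<bullet> q) +
     letter_concat (basis_vec (Suc k, d)) (shuffle p q)"
proof (induction p rule: pm_induct)
  case (step c w p)
  have "letter_concat (basis_vec (k, d)) (basis_vec w) \<bullet> q =
      letter_concat (basis_vec (k, d)) (basis_vec w \<bullet> q) +
      letter_concat (basis_vec (Suc k, d)) (shuffle (basis_vec w) q)"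
    by (induction q rule: pm_induct) (simp_all add: pm.scale_right_distrib)
  with step show ?case by (simp add: pm.scale_right_distrib)
qed simp

lemma forest_words_word_prod:
  "forest_words F \<bullet> q = (\<Sum>t\<in>#F. shuffle (forest_words (F - {#t#})) (tree_words t \<bullet> q))"
  unfolding forest_words_def
  by (rule derivation_shuffle_prod) (simp_all add: shuffle_word_prod)

lemma sum_mset_image_Union: "(\<Sum>x\<in>#(\<Sum>u\<in>#F. M u). f x) = (\<Sum>u\<in>#F. \<Sum>x\<in>#M u. f x)"
  by (induction F) simp_all

text \<open>Grafting at the root adds a child, which raises the number in the first letter; grafting
  below the root acts on one of the subtrees. These are the two terms of the product of words
  with a first letter, and on the shuffle of the subtrees the derivation property applies.\<close>

lemma sum_tree_words_graftings:
  "(\<Sum>s\<in>#graftings t t'. tree_words s) =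
     (tree_words t \<bullet> tree_words t' :: _ \<Rightarrow>\<^sub>0 'k::field)"
proof (induction t)
  case (Node d F)
  let ?x = "basis_vec (size F, d) :: _ \<Rightarrow>\<^sub>0 'k"
  have below: "(\<Sum>s\<in>#graftings u t'. tree_words (Node d (add_mset s (F - {#u#})))) =
      letter_concat ?x (shuffle (forest_words (F - {#u#})) (tree_words u \<bullet> tree_words t'))"
    if "u \<in># F" for u
  proof -
    let ?f = "\<lambda>p. letter_concat ?x (shuffle (forest_words (F - {#u#})) p)"
    have "tree_words (Node d (add_mset s (F - {#u#}))) = ?f (tree_words s)" for s
      using that by (simp add: forest_words_def shuffle_commute size_Suc_Diff1)
    then have "(\<Sum>s\<in>#graftings u t'. tree_words (Node d (add_mset s (F - {#u#})))) =
        (\<Sum>s\<in>#graftings u t'. ?f (tree_words s))" by (simp only:)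
    also have "\<dots> = ?f (\<Sum>s\<in>#graftings u t'. tree_words s)"
      by (rule additive_sum_mset[symmetric]) simp
    finally show ?thesis using Node[OF that] by simp
  qed
  have "(\<Sum>u\<in>#F. \<Sum>s\<in>#graftings u t'. tree_words (Node d (add_mset s (F - {#u#})))) =
      (\<Sum>u\<in>#F. letter_concat ?x (shuffle (forest_words (F - {#u#})) (tree_words u \<bullet> tree_words t')))"
    by (intro arg_cong[where f = sum_mset] image_mset_cong below)
  also have "\<dots> = letter_concat ?x (forest_words F \<bullet> tree_words t')"
    unfolding forest_words_word_prod
    by (rule additive_sum_mset[symmetric]) simp
  finally show ?case
    by (simp add: sum_mset_image_Union image_mset.compositionality o_def letter_concat_word_prod
        forest_words_def[symmetric] shuffle_commute)
qed

lemma lin_ext_tree_words_prod: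
  fixes p q :: "'d rtree \<Rightarrow>\<^sub>0 'k::field"
  shows "lin_ext tree_words (tree_prod p q) = lin_ext tree_words p \<bullet> lin_ext tree_words q"
proof (induction p rule: pm_induct)
  case (step c t p)
  have "lin_ext tree_words (tree_prod (basis_vec t) q) = tree_words t \<bullet> lin_ext tree_words q"
  proof (induction q rule: pm_induct)
    case (step c t' q)
    have "lin_ext tree_words (\<Sum>s\<in>#graftings t t'. basis_vec s :: _ \<Rightarrow>\<^sub>0 'k) = tree_words t \<bullet> tree_words t'"
      by (subst additive_sum_mset) (simp_all add: lin_ext_add sum_tree_words_graftings)
    with step show ?case by (simp add: lin_ext_add lin_ext_scale)
  qed simp
  with step show ?case by (simp add: lin_ext_add lin_ext_scale)
qed simp

section \<open>The two pre-Lie algebras\<close>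

lemma sum_mset_in_subspace:
  assumes "pm.subspace A" "\<And>x. x \<in># M \<Longrightarrow> g x \<in> A"
  shows "(\<Sum>x\<in>#M. g x) \<in> A"
  using assms(2) by (induction M) (auto intro: assms(1) pm.subspace_0 pm.subspace_add)

lemma subspace_Prelie: "pm.subspace (Prelie D)"
  unfolding Prelie_def by (rule subspace_free_space)

lemma subspace_tensor_space: "pm.subspace (tensor_space B)"
  unfolding tensor_space_def by (rule subspace_free_space)

lemma basis_vec_in_Prelie [simp]:
  "basis_vec t \<in> (Prelie D :: ('d rtree \<Rightarrow>\<^sub>0 'k::field) set) \<longleftrightarrow> decorations t \<subseteq> D"
  by (simp add: Prelie_def)

lemma basis_vec_in_tensor_space [simp]:
  "basis_vec w \<in> (tensor_space B :: ('b list \<Rightarrow>\<^sub>0 'k::field) set) \<longleftrightarrow> w \<in> lists B"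
  by (simp add: tensor_space_def)

lemma decorations_graftings:
  "s \<in># graftings t t' \<Longrightarrow> decorations s \<subseteq> decorations t \<union> decorations t'"
proof (induction t arbitrary: s)
  case (Node d F)
  from Node.prems consider "s = Node d (add_mset t' F)"
    | u r where "u \<in># F" "r \<in># graftings u t'" "s = Node d (add_mset r (F - {#u#}))"
    by auto
  then show ?case
  proof cases
    case 2
    with Node.IH[of u r] show ?thesis by (auto dest: in_diffD)
  qed auto
qed

lemma tree_prod_in_Prelie: "p \<in> Prelie D \<Longrightarrow> q \<in> Prelie D \<Longrightarrow> tree_prod p q \<in> Prelie D"
  unfolding tree_prod_def Prelie_def
proof (rule bilin_ext_in_subspace[OF _ _ subspace_free_space])
  fix t t'
  assume "t \<in> {t. decorations t \<subseteq> D}" "t' \<in> {t. decorations t \<subseteq> D}"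
  then have "decorations s \<subseteq> D" if "s \<in># graftings t t'" for s
    using decorations_graftings[OF that] by blast
  then show "(\<Sum>s\<in>#graftings t t'. basis_vec s) \<in> free_space {t. decorations t \<subseteq> D}"
    by (intro sum_mset_in_subspace[OF subspace_free_space]) simp
qed

lemma letter_concat_in_tensor_space:
  "v \<in> free_space B \<Longrightarrow> p \<in> tensor_space B \<Longrightarrow> letter_concat v p \<in> tensor_space B"
  unfolding letter_concat_def
  by (rule bilin_ext_in_subspace[OF _ _ subspace_tensor_space]) (auto simp: tensor_space_def)

lemma shuffle_words_in_tensor_space:
  "u \<in> lists B \<Longrightarrow> v \<in> lists B \<Longrightarrow> shuffle_words u v \<in> tensor_space B"
  by (induction u v rule: shuffle_words.induct)
    (auto intro!: pm.subspace_add[OF subspace_tensor_space] letter_concat_in_tensor_space)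

lemma shuffle_in_tensor_space:
  "p \<in> tensor_space B \<Longrightarrow> q \<in> tensor_space B \<Longrightarrow> shuffle p q \<in> tensor_space B"
  unfolding shuffle_def tensor_space_def
  by (rule bilin_ext_in_subspace[OF _ _ subspace_free_space])
    (auto intro: shuffle_words_in_tensor_space[unfolded tensor_space_def])

lemma tensor_prod_words_in_tensor_space:
  "u \<in> lists (biletters D) \<Longrightarrow> v \<in> lists (biletters D) \<Longrightarrow>
     tensor_prod_words f_biletter u v \<in> tensor_space (biletters D)"
  by (induction u)
    (auto simp: biletters_def pm.subspace_0[OF subspace_tensor_space]
      intro!: pm.subspace_add[OF subspace_tensor_space] letter_concat_in_tensor_space
        shuffle_words_in_tensor_space)

lemma word_prod_in_tensor_space:
  "p \<in> tensor_space (biletters D) \<Longrightarrow> q \<in> tensor_space (biletters D) \<Longrightarrow>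
     p \<bullet> q \<in> tensor_space (biletters D)"
  unfolding tensor_prod_def tensor_space_def
  by (rule bilin_ext_in_subspace[OF _ _ subspace_free_space])
    (auto intro: tensor_prod_words_in_tensor_space[unfolded tensor_space_def])

lemma tree_words_in_tensor_space:
  "decorations t \<subseteq> D \<Longrightarrow>
     (tree_words t :: _ \<Rightarrow>\<^sub>0 'k::field) \<in> tensor_space (biletters D)"
proof (induction t)
  case (Node d F)
  have "shuffle_prod (image_mset tree_words G :: (_ \<Rightarrow>\<^sub>0 'k) multiset)
      \<in> tensor_space (biletters D)" if "G \<subseteq># F" for G
    using that
  proof (induction G)
    case (add t G)
    then have "t \<in># F" "G \<subseteq># F" by (auto dest: mset_subset_eqD mset_subset_eq_insertD)
    moreover from this Node.prems have "decorations t \<subseteq> D" by auto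
    ultimately show ?case using add.IH Node.IH by (auto intro!: shuffle_in_tensor_space)
  qed simp
  with Node.prems show ?case
    by (auto intro!: letter_concat_in_tensor_space simp: biletters_def)
qed

lemma lin_ext_tree_words_in_tensor_space:
  "p \<in> Prelie D \<Longrightarrow> lin_ext tree_words p \<in> tensor_space (biletters D)"
  unfolding Prelie_def
  by (rule lin_ext_in_subspace[OF _ subspace_tensor_space]) (auto intro: tree_words_in_tensor_space)

lemma tensor_pre_lie_algebra:
  "pre_lie_algebra pm_scale (tensor_space (biletters D)) (tensor_prod f_biletter)"
  by unfold_locales
    (simp_all add: subspace_tensor_space word_prod_in_tensor_space word_prod_pre_lie)

text \<open>The pre-Lie identity for trees is the one for words, pulled back along an injective
  multiplicative map; this avoids the combinatorics of iterated graftings.\<close>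

lemma tree_prod_pre_lie:
  fixes p q r :: "'d rtree \<Rightarrow>\<^sub>0 'k::field_char_0"
  shows "tree_prod (tree_prod p q) r - tree_prod p (tree_prod q r) =
    tree_prod (tree_prod p r) q - tree_prod p (tree_prod r q)"
  by (rule lin_ext_tree_words_inject)
    (simp add: lin_ext_diff lin_ext_tree_words_prod word_prod_pre_lie)

lemma Prelie_pre_lie_algebra:
  "pre_lie_algebra pm_scale (Prelie D :: ('d rtree \<Rightarrow>\<^sub>0 'k::field_char_0) set) tree_prod"
  by unfold_locales (simp_all add: subspace_Prelie tree_prod_in_Prelie tree_prod_pre_lie)

lemma is_Phi_PL_lin_ext_tree_words:
  "is_Phi_PL D (lin_ext tree_words :: ('d rtree \<Rightarrow>\<^sub>0 'k::field_char_0) \<Rightarrow> _)"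
proof -
  have "pre_lie_hom pm_scale (Prelie D) tree_prod pm_scale (tensor_space (biletters D))
      (tensor_prod f_biletter) (lin_ext tree_words :: ('d rtree \<Rightarrow>\<^sub>0 'k) \<Rightarrow> _)"
    by (intro pre_lie_hom.intro pre_lie_hom_axioms.intro Prelie_pre_lie_algebra
        tensor_pre_lie_algebra lin_ext_tree_words_in_tensor_space lin_ext_add lin_ext_scale
        lin_ext_tree_words_prod)
  then show ?thesis
    by (simp add: is_Phi_PL_def generator_def)
qed

section \<open>Uniqueness\<close>

context pre_lie_hom
begin

lemma hom_zero: "\<phi> 0 = 0"
  using hom_scale[of 0 0] dom.subspace_0[OF dom.subspace_carrier] by simp

lemma hom_sum_mset:
  assumes "\<And>x. x \<in># M \<Longrightarrow> g x \<in> A"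
  shows "\<phi> (\<Sum>x\<in>#M. g x) = (\<Sum>x\<in>#M. \<phi> (g x))"
proof -
  have "(\<Sum>x\<in>#M. g x) \<in> A \<and> \<phi> (\<Sum>x\<in>#M. g x) = (\<Sum>x\<in>#M. \<phi> (g x))"
    using assms
    by (induction M)
      (auto simp: hom_zero hom_add dom.subspace_0[OF dom.subspace_carrier]
        intro: dom.subspace_add[OF dom.subspace_carrier])
  then show ?thesis ..
qed

end

lemma vertices_graftings: "s \<in># graftings t t' \<Longrightarrow> vertices s = vertices t + vertices t'"
proof (induction t arbitrary: s)
  case (Node d F)
  from Node.prems consider "s = Node d (add_mset t' F)"
    | u r where "u \<in># F" "r \<in># graftings u t'" "s = Node d (add_mset r (F - {#u#}))"
    by auto
  then show ?case
  proof cases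
    case 2
    with Node.IH[of u r] show ?thesis by (auto dest!: multi_member_split)
  qed auto
qed

text \<open>A tree whose root has a child \<open>t'\<close> is obtained by grafting \<open>t'\<close> at the root of the tree that
  remains when \<open>t'\<close> is cut off. All other trees in the product of these two have as many vertices
  but fewer children at the root, so induction on these two numbers shows that the one-vertex
  trees generate.\<close>

lemma pre_lie_hom_unique:
  assumes \<phi>: "pre_lie_hom pm_scale (Prelie D :: ('d rtree \<Rightarrow>\<^sub>0 'k::field) set) tree_prod
      s2 B m2 \<phi>"
    and \<psi>: "pre_lie_hom pm_scale (Prelie D) tree_prod s2 B m2 \<psi>"
    and generators: "\<And>d. d \<in> D \<Longrightarrow> \<phi> (generator d) = \<psi> (generator d)"
    and p: "p \<in> Prelie D"
  shows "\<phi> p = \<psi> p"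
proof -
  interpret \<phi>: pre_lie_hom pm_scale "Prelie D :: ('d rtree \<Rightarrow>\<^sub>0 'k) set" tree_prod s2 B m2 \<phi>
    by (rule \<phi>)
  interpret \<psi>: pre_lie_hom pm_scale "Prelie D :: ('d rtree \<Rightarrow>\<^sub>0 'k) set" tree_prod s2 B m2 \<psi>
    by (rule \<psi>)
  have trees: "\<phi> (basis_vec t) = \<psi> (basis_vec t)" if "decorations t \<subseteq> D" for t
    using that
  proof (induction t rule: wf_induct_rule[OF wf_measures[of "[vertices, \<lambda>t. size (children t)]"]])
    case (1 t)
    obtain d G where t: "t = Node d G" by (cases t)
    show ?case
    proof (cases G)
      case empty
      with 1 generators[of d] show ?thesis by (simp add: t generator_def)
    next
      case (add t' F)
      let ?a = "Node d F"
      let ?R = "\<Sum>u\<in>#F. {# Node d (add_mset s (F - {#u#})). s \<in># graftings u t' #}"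
      have graftings: "graftings ?a t' = add_mset t ?R"
        by (simp add: t add)
      have D: "decorations ?a \<subseteq> D" "decorations t' \<subseteq> D"
        using "1.prems" by (simp_all add: t add)
      have D_graftings: "decorations s \<subseteq> D" if "s \<in># graftings ?a t'" for s
        using decorations_graftings[OF that] D by blast
      have "\<phi> (basis_vec ?a) = \<psi> (basis_vec ?a)" "\<phi> (basis_vec t') = \<psi> (basis_vec t')"
        using D by (intro "1.IH"; simp add: t add vertices_pos)+
      then have "\<phi> (tree_prod (basis_vec ?a) (basis_vec t')) =
          \<psi> (tree_prod (basis_vec ?a) (basis_vec t'))"
        using D by (simp only: \<phi>.hom_prod \<psi>.hom_prod basis_vec_in_Prelie)
      then have "(\<Sum>s\<in>#graftings ?a t'. \<phi> (basis_vec s)) =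
          (\<Sum>s\<in>#graftings ?a t'. \<psi> (basis_vec s))"
        using D_graftings
        by (simp only: tree_prod_linear \<phi>.hom_sum_mset \<psi>.hom_sum_mset basis_vec_in_Prelie)
      moreover have "\<phi> (basis_vec s) = \<psi> (basis_vec s)" if "s \<in># ?R" for s
      proof (rule "1.IH")
        have s: "s \<in># graftings ?a t'" using that graftings by simp
        then show "decorations s \<subseteq> D" by (rule D_graftings)
        have "size (children s) = size F"
          using that by (auto simp: size_Suc_Diff1)
        with vertices_graftings[OF s]
        show "(s, t) \<in> measures [vertices, \<lambda>t. size (children t)]"
          by (simp add: t add)
      qed
      then have "(\<Sum>s\<in>#?R. \<phi> (basis_vec s)) = (\<Sum>s\<in>#?R. \<psi> (basis_vec s))"
        by (intro arg_cong[where f = sum_mset] image_mset_cong)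
      ultimately show ?thesis unfolding graftings by simp
    qed
  qed
  from p[unfolded Prelie_def] show ?thesis
  proof (induction rule: free_space_induct)
    case zero
    show ?case by (simp add: \<phi>.hom_zero \<psi>.hom_zero)
  next
    case (step c t q)
    then have "pm_scale c (basis_vec t) \<in> Prelie D"
      "basis_vec t \<in> (Prelie D :: ('d rtree \<Rightarrow>\<^sub>0 'k) set)" "q \<in> Prelie D"
      by (auto simp: Prelie_def[symmetric] intro: pm.subspace_scale[OF subspace_Prelie])
    with step show ?case
      by (simp add: \<phi>.hom_add \<psi>.hom_add \<phi>.hom_scale \<psi>.hom_scale trees)
  qed
qed

theorem theorem30:
  fixes D :: "'d set"
  shows "(\<exists>\<Phi> :: ('d rtree \<Rightarrow>\<^sub>0 'k::field_char_0) \<Rightarrow> ((nat \<times> 'd) list \<Rightarrow>\<^sub>0 'k). is_Phi_PL D \<Phi>) \<and>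
    (\<forall>\<Phi> :: ('d rtree \<Rightarrow>\<^sub>0 'k) \<Rightarrow> ((nat \<times> 'd) list \<Rightarrow>\<^sub>0 'k).
       is_Phi_PL D \<Phi> \<longrightarrow> inj_on \<Phi> (Prelie D))"
proof -
  have Phi: "is_Phi_PL D (lin_ext tree_words :: ('d rtree \<Rightarrow>\<^sub>0 'k) \<Rightarrow> _)"
    by (rule is_Phi_PL_lin_ext_tree_words)
  have "inj_on \<Phi> (Prelie D)"
    if "is_Phi_PL D \<Phi>" for \<Phi> :: "('d rtree \<Rightarrow>\<^sub>0 'k) \<Rightarrow> ((nat \<times> 'd) list \<Rightarrow>\<^sub>0 'k)"
  proof (rule inj_onI)
    have eq: "\<Phi> p = lin_ext tree_words p" if "p \<in> Prelie D" for p
      by (rule pre_lie_hom_unique[where ?s2.0 = pm_scale and ?m2.0 = "tensor_prod f_biletter"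
            and B = "tensor_space (biletters D)", OF _ _ _ that])
        (use Phi \<open>is_Phi_PL D \<Phi>\<close> in \<open>simp_all add: is_Phi_PL_def\<close>)
    fix p q
    assume "p \<in> Prelie D" "q \<in> Prelie D" "\<Phi> p = \<Phi> q"
    then show "p = q"
      by (intro lin_ext_tree_words_inject) (simp add: eq)
  qed
  with Phi show ?thesis by blast
qed

end
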